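(* Let $n\in\mathbb{N}$. Define $$H_n([0,\infty)) := \big\{f:[0,\infty)\to\mathbb{C} \,\big|\, f^{(j)}\in AC_{loc}([0,\infty)),\ j=0,\dots,n-1;\ f^{(n)}\in L^2((0,\infty));\ f^{(j)}(0)=0,\ j=0,\dots,n-1\big\}$$ and $$\widehat H_n((0,\infty)) := \big\{f:(0,\infty)\to\mathbb{C} \,\big|\, f^{(j)}\in AC_{loc}((0,\infty)),\ j=0,\dots,n-1;\ f^{(n)},\ f/x^{n}\in L^2((0,\infty))\big\}.$$ Then $H_n([0,\infty))=\widehat H_n((0,\infty))$ as sets, in the following sense: if $f\in H_n([0,\infty))$ then its restriction to $(0,\infty)$ lies in $\widehat H_n((0,\infty))$; and if $f\in\widehat H_n((0,\infty))$, then the limits $f^{(j)}(0_+)=\lim_{x\downarrow0}f^{(j)}(x)$, $j=0,\dots,n-1$, exist and are finite, and the extension of $f$ to $[0,\infty)$ by $f(0):=f(0_+)$ belongs to $H_n([0,\infty))$.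
   Context: $AC_{loc}([0,\infty))$ denotes functions absolutely continuous on $[0,c]$ for every $c>0$; $AC_{loc}((0,\infty))$ denotes functions absolutely continuous on every compact subinterval of $(0,\infty)$. *)

theory Defs
  imports "HOL-Analysis.Analysis"
begin

definition ac_on :: "real set \<Rightarrow> (real \<Rightarrow> 'b::real_normed_vector) \<Rightarrow> bool" where
  "ac_on S g \<longleftrightarrow>
     (\<forall>\<epsilon>>0. \<exists>\<delta>>0. \<forall>(d :: nat \<Rightarrow> real \<times> real) (m::nat).
        (\<forall>k<m. fst (d k) \<le> snd (d k) \<and> {fst (d k)..snd (d k)} \<subseteq> S) \<and>
        (\<forall>k<m. \<forall>l<m. k \<noteq> l \<longrightarrow>
            {fst (d k)<..<snd (d k)} \<inter> {fst (d l)<..<snd (d l)} = {}) \<and>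
        (\<Sum>k<m. snd (d k) - fst (d k)) < \<delta>
        \<longrightarrow> (\<Sum>k<m. norm (g (snd (d k)) - g (fst (d k)))) < \<epsilon>)"

definition ac_loc_closed :: "(real \<Rightarrow> 'b::real_normed_vector) \<Rightarrow> bool" where
  "ac_loc_closed g \<longleftrightarrow> (\<forall>c>0. ac_on {0..c} g)"

definition ac_loc_open :: "(real \<Rightarrow> 'b::real_normed_vector) \<Rightarrow> bool" where
  "ac_loc_open g \<longleftrightarrow> (\<forall>a b. 0 < a \<longrightarrow> a \<le> b \<longrightarrow> ac_on {a..b} g)"

definition L2_on :: "real set \<Rightarrow> (real \<Rightarrow> complex) \<Rightarrow> bool" where
  "L2_on S h \<longleftrightarrow> h \<in> borel_measurable (lebesgue_on S) \<and>
                 integrable (lebesgue_on S) (\<lambda>x. (norm (h x))\<^sup>2)"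

text \<open>g 0, ..., g n are the derivatives f^(0), ..., f^(n) of f on [0,oo), witnessing
  membership of f in H_n([0,oo)). The derivatives are understood in the
  AC sense: g (j+1) is the (a.e.) derivative of the absolutely continuous g j.\<close>
definition H_derivs :: "nat \<Rightarrow> (real \<Rightarrow> complex) \<Rightarrow> (nat \<Rightarrow> real \<Rightarrow> complex) \<Rightarrow> bool" where
  "H_derivs n f g \<longleftrightarrow>
     (\<forall>x\<ge>0. g 0 x = f x) \<and>
     (\<forall>j<n. ac_loc_closed (g j)) \<and>
     (\<forall>j<n. AE x in lebesgue. x > 0 \<longrightarrow>
          (g j has_vector_derivative g (Suc j) x) (at x)) \<and>
     L2_on {0<..} (g n) \<and>
     (\<forall>j<n. g j 0 = 0)"

definition H_space :: "nat \<Rightarrow> (real \<Rightarrow> complex) set" where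
  "H_space n = {f. \<exists>g. H_derivs n f g}"

definition Hhat_derivs :: "nat \<Rightarrow> (real \<Rightarrow> complex) \<Rightarrow> (nat \<Rightarrow> real \<Rightarrow> complex) \<Rightarrow> bool" where
  "Hhat_derivs n f g \<longleftrightarrow>
     (\<forall>x>0. g 0 x = f x) \<and>
     (\<forall>j<n. ac_loc_open (g j)) \<and>
     (\<forall>j<n. AE x in lebesgue. x > 0 \<longrightarrow>
          (g j has_vector_derivative g (Suc j) x) (at x)) \<and>
     L2_on {0<..} (g n) \<and>
     L2_on {0<..} (\<lambda>x. f x / of_real (x ^ n))"

definition Hhat_space :: "nat \<Rightarrow> (real \<Rightarrow> complex) set" where
  "Hhat_space n = {f. \<exists>g. Hhat_derivs n f g}"

end

theory Submission
  imports Defs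
begin

text \<open>If \<open>f \<in> H\<^sub>n\<close>, iterated integration gives
  \<open>|f x| \<le> x ^ (n - 1) * (\<integral>t\<in>{0..x}. |f\<^sup>(\<^sup>n\<^sup>) t|)\<close>, so \<open>|f| / x ^ n\<close> is at most the running mean of
  \<open>|f\<^sup>(\<^sup>n\<^sup>)|\<close>, which is square integrable by Hardy's inequality.
  Conversely, \<open>f\<^sup>(\<^sup>n\<^sup>)\<close> is integrable near 0; integrating downwards, every lower derivative has a
  limit at 0 and its extension is locally absolutely continuous. A first nonvanishing limit, of
  index \<open>m < n\<close>, would make \<open>f / x ^ n\<close> of order \<open>x ^ m / x ^ n\<close>, which is not
  square integrable near 0.\<close>

subsection \<open>Absolute continuity and the fundamental theorem of calculus\<close>

text \<open>The obstacle is that derivatives are known only almost everywhere, which alone says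
  nothing about increments (the Cantor function has derivative 0 a.e.), while \<open>ac_on\<close>
  is the bare epsilon-delta condition. Both directions therefore work with the identity
  \<open>(h has_integral g t - g s) {s..t}\<close>: absolute continuity yields it once, by a gauge
  argument, and all later estimates are estimates of integrals. The way back to \<open>ac_on\<close>
  rests on square integrability of \<open>h\<close>, and this property reproduces itself: an
  antiderivative extends continuously to 0, hence is again square integrable on bounded intervals.
  The borderline case of the converse is \<open>1 / x\<close>, whose square is not integrable at 0:
  since \<open>m < n\<close>, a nonzero limit of index \<open>m\<close> forces
  \<open>f / x ^ n\<close> to be at least of that size. The direct inclusion has no such threshold,
  because the running mean of an L^2 function stays in L^2.\<close>

definition nonoverlapping :: "'i set \<Rightarrow> ('i \<Rightarrow> real) \<Rightarrow> ('i \<Rightarrow> real) \<Rightarrow> real set \<Rightarrow> bool" where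
  "nonoverlapping I u v S \<longleftrightarrow> finite I \<and> (\<forall>i\<in>I. u i \<le> v i \<and> {u i..v i} \<subseteq> S) \<and>
     (\<forall>i\<in>I. \<forall>j\<in>I. i \<noteq> j \<longrightarrow> {u i<..<v i} \<inter> {u j<..<v j} = {})"

text \<open>Two of the intervals share at most endpoints, a negligible set, so the integrals add up
  to the integral over the union. With \<open>q = 1\<close> this bounds a total length by the
  measure of an open set; with \<open>q\<close> the square of a norm it bounds sums of
  energies.\<close>

lemma sum_integral_nonoverlapping_le:
  fixes q :: "real \<Rightarrow> real"
  assumes I: "nonoverlapping I u v S"
    and q: "q integrable_on S" and nonneg: "\<And>x. x \<in> S \<Longrightarrow> 0 \<le> q x"
    and int: "\<And>i. i \<in> I \<Longrightarrow> q integrable_on {u i..v i}"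
  shows "(\<Sum>i\<in>I. integral {u i..v i} q) \<le> integral S q"
proof -
  have neg: "negligible ({u i..v i} \<inter> {u j..v j})" if "i \<in> I" "j \<in> I" "i \<noteq> j" for i j
  proof (rule negligible_subset)
    show "negligible {u i, v i, u j, v j}"
      by (intro negligible_finite) auto
    show "{u i..v i} \<inter> {u j..v j} \<subseteq> {u i, v i, u j, v j}"
    proof
      fix x assume x: "x \<in> {u i..v i} \<inter> {u j..v j}"
      have "{u i<..<v i} \<inter> {u j<..<v j} = {}"
        using I that by (auto simp: nonoverlapping_def)
      then have "\<not> (u i < x \<and> x < v i \<and> u j < x \<and> x < v j)"
        by (metis IntI empty_iff greaterThanLessThan_iff)
      with x show "x \<in> {u i, v i, u j, v j}" by auto
    qed
  qed
  have "(q has_integral (\<Sum>i\<in>I. integral {u i..v i} q)) (\<Union>i\<in>I. {u i..v i})"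
    using I int neg by (intro has_integral_UN) (auto simp: pairwise_def nonoverlapping_def)
  moreover have "(\<Union>i\<in>I. {u i..v i}) \<subseteq> S"
    using I by (auto simp: nonoverlapping_def subset_eq)
  ultimately show ?thesis
    using has_integral_subset_le q nonneg by blast
qed

lemma ac_on_subset:
  assumes "ac_on S g" "T \<subseteq> S"
  shows "ac_on T g"
  unfolding ac_on_def
proof (intro allI impI, goal_cases)
  case (1 e)
  from assms(1)[unfolded ac_on_def, THEN spec, THEN mp, OF 1]
  show ?case
  proof (elim exE conjE, goal_cases)
    case (1 d)
    note d = 1
    show ?case
    proof (intro exI[of _ d] conjI allI impI d(1), goal_cases)
      case (1 w m)
      then show ?case
        using order_trans[OF _ assms(2)] by (intro d(2)[rule_format]) blast
    qed
  qed
qed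

text \<open>An enumeration of the finite index set turns the family into one indexed by
  \<open>{..<m}\<close>. Arbitrary index types are wanted because a tagged division is naturally
  indexed by its own tag-interval pairs.\<close>

lemma ac_onD:
  assumes "ac_on S g" "0 < e"
  shows "\<exists>d>0. \<forall>(I :: 'i set) u v. nonoverlapping I u v S \<longrightarrow> (\<Sum>i\<in>I. v i - u i) < d \<longrightarrow>
           (\<Sum>i\<in>I. norm (g (v i) - g (u i))) < e"
proof -
  from assms(1)[unfolded ac_on_def, THEN spec, THEN mp, OF assms(2)]
  obtain d where "d > 0" and d: "\<forall>(w :: nat \<Rightarrow> real \<times> real) m.
        (\<forall>k<m. fst (w k) \<le> snd (w k) \<and> {fst (w k)..snd (w k)} \<subseteq> S) \<and>
        (\<forall>k<m. \<forall>l<m. k \<noteq> l \<longrightarrow> {fst (w k)<..<snd (w k)} \<inter> {fst (w l)<..<snd (w l)} = {}) \<and>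
        (\<Sum>k<m. snd (w k) - fst (w k)) < d
        \<longrightarrow> (\<Sum>k<m. norm (g (snd (w k)) - g (fst (w k)))) < e"
    by (elim exE conjE) (rule that)
  show ?thesis
  proof (intro exI[of _ d] conjI allI impI \<open>d > 0\<close>)
    fix I and u v :: "'i \<Rightarrow> real"
    assume I: "nonoverlapping I u v S" and less: "(\<Sum>i\<in>I. v i - u i) < d"
    have uv: "u i \<le> v i \<and> {u i..v i} \<subseteq> S" if "i \<in> I" for i
      using I that by (simp add: nonoverlapping_def)
    have disj: "{u i<..<v i} \<inter> {u j<..<v j} = {}" if "i \<in> I" "j \<in> I" "i \<noteq> j" for i j
      using I that unfolding nonoverlapping_def by blast
    have "finite I" using I by (simp add: nonoverlapping_def)
    then obtain h where h: "bij_betw h {..<card I} I"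
      using ex_bij_betw_nat_finite by (auto simp: lessThan_atLeast0)
    then have hI: "h k \<in> I" if "k < card I" for k
      using that by (auto simp: bij_betw_def)
    have hinj: "h k \<noteq> h l" if "k < card I" "l < card I" "k \<noteq> l" for k l
      using h that by (auto simp: bij_betw_def inj_on_def)
    have sum: "(\<Sum>i\<in>I. F i) = (\<Sum>k<card I. F (h k))" for F :: "'i \<Rightarrow> real"
      by (rule sum.reindex_bij_betw[OF h, symmetric])
    show "(\<Sum>i\<in>I. norm (g (v i) - g (u i))) < e"
      using d[rule_format, of "card I" "\<lambda>k. (u (h k), v (h k))"]
        uv[OF hI] disj[OF hI hI hinj] less
      by (simp add: sum)
  qed
qed

lemma ac_on_imp_continuous_on:
  assumes "ac_on {a..b} g"
  shows "continuous_on {a..b} g"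
  unfolding continuous_on_iff
proof (intro ballI allI impI)
  fix x and e :: real assume x: "x \<in> {a..b}" and "e > 0"
  from ac_onD[OF assms \<open>e > 0\<close>] obtain d where "d > 0" and
    d: "\<forall>(I :: unit set) u v. nonoverlapping I u v {a..b} \<longrightarrow> (\<Sum>i\<in>I. v i - u i) < d \<longrightarrow>
       (\<Sum>i\<in>I. norm (g (v i) - g (u i))) < e"
    by blast
  have *: "norm (g t - g s) < e" if "s \<in> {a..b}" "t \<in> {a..b}" "s \<le> t" "t - s < d" for s t
    using d[rule_format, of "{()}" "\<lambda>_. s" "\<lambda>_. t"] that by (simp add: nonoverlapping_def)
  show "\<exists>d>0. \<forall>x'\<in>{a..b}. dist x' x < d \<longrightarrow> dist (g x') (g x) < e"
  proof (intro exI[of _ d] conjI ballI impI \<open>d > 0\<close>)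
    fix y assume "y \<in> {a..b}" "dist y x < d"
    then show "dist (g y) (g x) < e"
      using *[of x y] *[of y x] x by (cases "x \<le> y") (auto simp: dist_norm norm_minus_commute)
  qed
qed

text \<open>A gauge argument: off the exceptional null set the derivative controls the increments of
  \<open>g\<close>; the intervals tagged inside it have small total length, so absolute continuity applies.\<close>

lemma fundamental_theorem_of_calculus_ac:
  fixes g :: "real \<Rightarrow> 'b::euclidean_space"
  assumes "a \<le> b" and ac: "ac_on {a..b} g"
    and deriv: "AE x in lebesgue. x \<in> {a<..<b} \<longrightarrow> (g has_vector_derivative h x) (at x)"
  shows "(h has_integral g b - g a) {a..b}"
proof -
  \<comment> \<open>The endpoints join the exceptional set because differentiability is assumed only
    in the interior.\<close>
  define N where "N = {a, b} \<union> {x \<in> {a<..<b}. \<not> (g has_vector_derivative h x) (at x)}"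
  \<comment> \<open>Setting the integrand to 0 on \<open>N\<close> leaves only the increment of
    \<open>g\<close> on an interval tagged in \<open>N\<close>.\<close>
  define k where "k x = (if x \<in> N then 0 else h x)" for x
  have negN: "negligible N"
  proof -
    obtain B where B: "B \<in> null_sets lebesgue"
      "{x \<in> space lebesgue. \<not> (x \<in> {a<..<b} \<longrightarrow> (g has_vector_derivative h x) (at x))} \<subseteq> B"
      using deriv unfolding eventually_ae_filter by blast
    then have "negligible (B \<union> {a, b})"
      by (intro negligible_Un) (auto simp: negligible_iff_null_sets)
    then show ?thesis
      by (rule negligible_subset) (use B in \<open>auto simp: N_def\<close>)
  qed
  have "(k has_integral g b - g a) {a..b}"
    unfolding has_integral_real
  proof (intro allI impI)
    fix e :: real assume "e > 0"
    \<comment> \<open>The slope error allowed at good tags: over the whole interval it costs less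
      than \<open>e / 2\<close>. The summand 1 covers the case \<open>a = b\<close>.\<close>
    define c where "c = e / (2 * (b - a + 1))"
    have "c > 0" and c: "c * (b - a) < e / 2"
      using \<open>e > 0\<close> \<open>a \<le> b\<close> by (auto simp: c_def field_simps intro: add_pos_pos)
    have "e / 2 > 0" using \<open>e > 0\<close> by simp
    from ac_onD[OF ac this] obtain d where "d > 0" and
      d: "\<forall>(I :: (real \<times> real set) set) u v. nonoverlapping I u v {a..b} \<longrightarrow>
       (\<Sum>i\<in>I. v i - u i) < d \<longrightarrow> (\<Sum>i\<in>I. norm (g (v i) - g (u i))) < e / 2"
      by blast
    \<comment> \<open>Inside \<open>N\<close> the gauge is \<open>U\<close>, so all intervals tagged
      there lie in \<open>U\<close> and have total length below the \<open>d\<close> of absolute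
      continuity.\<close>
    obtain U where "open U" "N \<subseteq> U" and U: "U \<in> lmeasurable" "measure lebesgue U < d"
    proof -
      obtain T where T: "open T" "N \<subseteq> T" "T - N \<in> lmeasurable" "emeasure lebesgue (T - N) < ennreal d"
        using sets_lebesgue_outer_open[of N d] negN \<open>d > 0\<close> negligible_imp_sets by blast
      have "T = (T - N) \<union> N" using T by auto
      then have "T \<in> lmeasurable" "measure lebesgue T = measure lebesgue (T - N)"
        using T(3) negN
        by (metis fmeasurable.Un negligible_imp_measurable,
            metis measure_Un_null_set negligible_iff_null_sets fmeasurableD)
      moreover have "measure lebesgue (T - N) < d"
        using T(3,4) \<open>d > 0\<close> by (simp add: emeasure_eq_measure2 ennreal_less_iff)
      ultimately show thesis using that T by simp
    qed
    have "\<exists>r>0. x \<in> {a<..<b} - N \<longrightarrow>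
            (\<forall>y. norm (y - x) < r \<longrightarrow> norm (g y - g x - (y - x) *\<^sub>R h x) \<le> c * norm (y - x))" for x
    proof (cases "x \<in> {a<..<b} - N")
      case True
      then have "(g has_vector_derivative h x) (at x)"
        by (auto simp: N_def)
      then show ?thesis
        using \<open>c > 0\<close> unfolding has_vector_derivative_def has_derivative_at_alt by blast
    qed (auto intro: exI[of _ 1])
    then obtain r where r: "\<And>x. r x > 0"
      "\<And>x y. x \<in> {a<..<b} - N \<Longrightarrow> norm (y - x) < r x \<Longrightarrow>
         norm (g y - g x - (y - x) *\<^sub>R h x) \<le> c * norm (y - x)"
      by metis
    show "\<exists>\<gamma>. gauge \<gamma> \<and> (\<forall>\<D>. \<D> tagged_division_of {a..b} \<and> \<gamma> fine \<D> \<longrightarrow>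
        norm ((\<Sum>(x,k')\<in>\<D>. measure lborel k' *\<^sub>R k x) - (g b - g a)) < e)"
    proof (intro exI conjI allI impI)
      let ?\<gamma> = "\<lambda>x. if x \<in> N then U else ball x (r x)"
      show "gauge ?\<gamma>"
        using \<open>open U\<close> \<open>N \<subseteq> U\<close> r(1) by (auto simp: gauge_def)
      fix p assume "p tagged_division_of {a..b} \<and> ?\<gamma> fine p"
      then have p: "p tagged_division_of {a..b}" and fine: "?\<gamma> fine p" by auto
      note pD = tagged_division_ofD[OF p]
      have form: "\<exists>s t. K = {s..t} \<and> s \<le> x \<and> x \<le> t \<and> Inf K = s \<and> Sup K = t \<and> a \<le> s \<and> t \<le> b"
        if xK: "(x, K) \<in> p" for x K
      proof -
        obtain s t where "K = {s..t}" using pD(4)[OF xK] by auto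
        then show ?thesis using pD(2,3)[OF xK] by auto
      qed
      define q where "q = {z \<in> p. fst z \<in> N}"
      have qp: "q \<subseteq> p" "finite q" "finite (p - q)" using pD(1) by (auto simp: q_def)
      \<comment> \<open>The error of one tagged interval; the increments of \<open>g\<close>
        telescope to \<open>g b - g a\<close>, so the total error is the sum of these.\<close>
      define D where "D z = measure lborel (snd z) *\<^sub>R k (fst z) - (g (Sup (snd z)) - g (Inf (snd z)))"
        for z :: "real \<times> real set"
      have "(\<Sum>(x,K)\<in>p. measure lborel K *\<^sub>R k x) - (g b - g a) = (\<Sum>z\<in>p. D z)"
        using additive_tagged_division_1[OF \<open>a \<le> b\<close> p, of g]
        by (simp add: D_def sum_subtractf case_prod_unfold)
      also have "\<dots> = (\<Sum>z\<in>q. D z) + (\<Sum>z\<in>p - q. D z)"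
        using qp pD(1) by (metis sum.subset_diff add.commute)
      finally have split: "(\<Sum>(x,K)\<in>p. measure lborel K *\<^sub>R k x) - (g b - g a) =
          (\<Sum>z\<in>q. D z) + (\<Sum>z\<in>p - q. D z)" .
      have "norm (\<Sum>z\<in>p - q. D z) \<le> (\<Sum>z\<in>p - q. c * measure lborel (snd z))"
      proof (rule sum_norm_le)
        fix z assume "z \<in> p - q"
        moreover obtain x K where z: "z = (x, K)" by (cases z)
        ultimately have xK: "(x, K) \<in> p" "x \<notin> N" by (auto simp: q_def)
        obtain s t where K: "K = {s..t}" "s \<le> x" "x \<le> t" "a \<le> s" "t \<le> b"
          using form[OF xK(1)] by auto
        have x: "x \<in> {a<..<b} - N" using K xK(2) by (auto simp: N_def less_le)
        have "K \<subseteq> ball x (r x)"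
          using fineD[OF fine xK(1)] xK(2) by auto
        moreover have "s \<in> K" "t \<in> K" using K by auto
        ultimately have "norm (s - x) < r x" "norm (t - x) < r x"
          by (auto simp: dist_real_def subset_eq abs_minus_commute)
        moreover have "norm (s - x) = x - s" "norm (t - x) = t - x"
          using K by auto
        ultimately have "norm (g s - g x - (s - x) *\<^sub>R h x) \<le> c * (x - s)"
          "norm (g t - g x - (t - x) *\<^sub>R h x) \<le> c * (t - x)"
          using r(2)[OF x, of s] r(2)[OF x, of t] by simp_all
        \<comment> \<open>The tag lies between \<open>s\<close> and \<open>t\<close>, so comparing
          both ends with \<open>g x\<close> makes the two errors add up to \<open>c\<close> times
          the length.\<close>
        moreover have "D z = (g s - g x - (s - x) *\<^sub>R h x) - (g t - g x - (t - x) *\<^sub>R h x)"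
          using K xK(2) by (simp add: z D_def k_def algebra_simps)
        then have "norm (D z) \<le> norm (g s - g x - (s - x) *\<^sub>R h x) + norm (g t - g x - (t - x) *\<^sub>R h x)"
          by (simp only: norm_triangle_ineq4)
        ultimately have "norm (D z) \<le> c * (x - s) + c * (t - x)"
          by linarith
        also have "\<dots> = c * measure lborel (snd z)"
          using K by (simp add: z algebra_simps)
        finally show "norm (D z) \<le> c * measure lborel (snd z)" .
      qed
      also have "\<dots> \<le> (\<Sum>z\<in>p. c * measure lborel (snd z))"
        using pD(1) \<open>c > 0\<close> by (intro sum_mono2) auto
      also have "\<dots> = c * (b - a)"
        using additive_content_tagged_division[of p a b] p \<open>a \<le> b\<close>
        by (simp add: sum_distrib_left[symmetric] case_prod_unfold)
      finally have rest: "norm (\<Sum>z\<in>p - q. D z) < e / 2" using c by simp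
      have "norm (\<Sum>z\<in>q. D z) \<le> (\<Sum>z\<in>q. norm (g (Sup (snd z)) - g (Inf (snd z))))"
        by (rule sum_norm_le) (auto simp: D_def k_def q_def norm_minus_commute)
      also have "\<dots> < e / 2"
      proof (rule d[rule_format])
        have ivl: "snd z = {Inf (snd z)..Sup (snd z)} \<and> Inf (snd z) \<le> Sup (snd z) \<and>
             a \<le> Inf (snd z) \<and> Sup (snd z) \<le> b \<and> snd z \<subseteq> U" if "z \<in> q" for z
        proof -
          obtain x K where z: "z = (x, K)" by (cases z)
          with that have xK: "(x, K) \<in> p" "x \<in> N" by (auto simp: q_def)
          then show ?thesis using form[OF xK(1)] fineD[OF fine xK(1)] z by auto
        qed
        have disj: "{Inf (snd z)<..<Sup (snd z)} \<inter> {Inf (snd w)<..<Sup (snd w)} = {}"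
          if "z \<in> q" "w \<in> q" "z \<noteq> w" for z w
        proof -
          have "interior (snd z) \<inter> interior (snd w) = {}"
            using pD(5)[of "fst z" "snd z" "fst w" "snd w"] that qp by auto
          moreover have "interior (snd z) = {Inf (snd z)<..<Sup (snd z)}"
            "interior (snd w) = {Inf (snd w)<..<Sup (snd w)}"
            using ivl that by (metis interior_atLeastAtMost_real)+
          ultimately show ?thesis by simp
        qed
        show "nonoverlapping q (\<lambda>z. Inf (snd z)) (\<lambda>z. Sup (snd z)) {a..b}"
        proof -
          have "{Inf (snd z)..Sup (snd z)} \<subseteq> {a..b}" if "z \<in> q" for z
          proof -
            have "a \<le> Inf (snd z)" "Sup (snd z) \<le> b" using ivl[OF that] by blast+
            then show ?thesis by simp
          qed
          then show ?thesis
            unfolding nonoverlapping_def using qp(2) disj ivl by blast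
        qed
        have qU: "nonoverlapping q (\<lambda>z. Inf (snd z)) (\<lambda>z. Sup (snd z)) U"
          unfolding nonoverlapping_def using qp(2) disj ivl by metis
        have "(\<Sum>z\<in>q. Sup (snd z) - Inf (snd z)) =
              (\<Sum>z\<in>q. integral {Inf (snd z)..Sup (snd z)} (\<lambda>x. 1))"
        proof (rule sum.cong[OF refl])
          fix z assume "z \<in> q"
          then have "Inf (snd z) \<le> Sup (snd z)" using ivl by blast
          then show "Sup (snd z) - Inf (snd z) = integral {Inf (snd z)..Sup (snd z)} (\<lambda>x. 1)"
            by simp
        qed
        also have "\<dots> \<le> integral U (\<lambda>x. 1)"
          using integrable_on_const[OF U(1)] by (intro sum_integral_nonoverlapping_le[OF qU]) auto
        also have "\<dots> < d" using U by (simp add: lmeasure_integral)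
        finally show "(\<Sum>z\<in>q. Sup (snd z) - Inf (snd z)) < d" .
      qed
      finally have "norm (\<Sum>z\<in>q. D z) < e / 2" .
      with rest show "norm ((\<Sum>(x,k')\<in>p. measure lborel k' *\<^sub>R k x) - (g b - g a)) < e"
        unfolding split by (metis field_sum_of_halves norm_add_less)
    qed
  qed
  then show ?thesis
    by (rule has_integral_spike[OF negN, rotated]) (auto simp: k_def)
qed

text \<open>Since \<open>norm (h x)\<close> is at most
  \<open>c * (norm (h x))\<^sup>2 + 1 / c\<close>, the increments over disjoint intervals sum to at
  most \<open>c * M\<close> plus the total length over \<open>c\<close>. A small \<open>c\<close>
  controls the first term, and then a total length below \<open>c * e / 2\<close> the
  second.\<close>

lemma ac_onI_square_integrable:
  fixes g :: "real \<Rightarrow> 'b::euclidean_space"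
  assumes ftc: "\<And>s t. a \<le> s \<Longrightarrow> s \<le> t \<Longrightarrow> t \<le> b \<Longrightarrow> (h has_integral g t - g s) {s..t}"
    and sq: "(\<lambda>x. (norm (h x))\<^sup>2) integrable_on {a..b}"
  shows "ac_on {a..b} g"
  unfolding ac_on_def
proof (intro allI impI, goal_cases)
  case (1 e)
  let ?q = "\<lambda>x. (norm (h x))\<^sup>2"
  define M where "M = integral {a..b} ?q"
  have "M \<ge> 0" unfolding M_def by (rule integral_nonneg[OF sq]) simp
  define c where "c = e / (2 * (M + 1))"
  have "c > 0" and c: "c * M < e / 2"
    using \<open>0 < e\<close> \<open>M \<ge> 0\<close> by (auto simp: c_def field_simps intro: add_pos_nonneg)
  have bound: "norm (h x) \<le> c * ?q x + 1 / c" for x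
  proof -
    have "0 \<le> (c * norm (h x) - 1)\<^sup>2 + c * norm (h x)" using \<open>c > 0\<close> by simp
    then have "c * norm (h x) \<le> c * (c * ?q x + 1 / c)"
      using \<open>c > 0\<close> by (simp add: power2_eq_square algebra_simps)
    then show ?thesis using \<open>c > 0\<close> by simp
  qed
  show ?case
  proof (intro exI[of _ "c * e / 2"] conjI allI impI, goal_cases)
    case 1 then show ?case using \<open>0 < e\<close> \<open>c > 0\<close> by simp
  next
    case (2 w m)
    have no: "nonoverlapping {..<m} (fst \<circ> w) (snd \<circ> w) {a..b}"
      using 2 unfolding nonoverlapping_def by fastforce
    have w: "a \<le> fst (w k)" "fst (w k) \<le> snd (w k)" "snd (w k) \<le> b" if "k < m" for k
      using 2 that by force+
    have int: "?q integrable_on {fst (w k)..snd (w k)}" if "k < m" for k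
      using integrable_on_subinterval[OF sq] w[OF that] by auto
    have "norm (g (snd (w k)) - g (fst (w k))) \<le>
        c * integral {fst (w k)..snd (w k)} ?q + (snd (w k) - fst (w k)) / c" if "k < m" for k
    proof -
      have "norm (integral {fst (w k)..snd (w k)} h) \<le>
          integral {fst (w k)..snd (w k)} (\<lambda>x. c * ?q x + 1 / c)"
        using ftc[OF w[OF that]] int[OF that] bound
        by (intro integral_norm_bound_integral integrable_add integrable_on_mult_right) auto
      also have "\<dots> = c * integral {fst (w k)..snd (w k)} ?q + (snd (w k) - fst (w k)) / c"
        using int[OF that] w[OF that] by (subst integral_add) (auto intro: integrable_on_mult_right)
      finally show ?thesis using ftc[OF w[OF that]] by (simp add: integral_unique)
    qed
    then have "(\<Sum>k<m. norm (g (snd (w k)) - g (fst (w k)))) \<le>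
        (\<Sum>k<m. c * integral {fst (w k)..snd (w k)} ?q + (snd (w k) - fst (w k)) / c)"
      by (intro sum_mono) simp
    also have "\<dots> = c * (\<Sum>k<m. integral {fst (w k)..snd (w k)} ?q) +
        (\<Sum>k<m. snd (w k) - fst (w k)) / c"
      by (simp add: sum.distrib sum_distrib_left sum_divide_distrib)
    also have "\<dots> \<le> c * M + (c * e / 2) / c"
    proof (intro add_mono mult_left_mono divide_right_mono)
      show "(\<Sum>k<m. integral {fst (w k)..snd (w k)} ?q) \<le> M"
        using sum_integral_nonoverlapping_le[OF no sq] int by (simp add: M_def)
    qed (use 2 \<open>c > 0\<close> in auto)
    also have "\<dots> < e" using c \<open>c > 0\<close> by simp
    finally show ?case .
  qed
qed

section \<open>Square integrable functions and orders of growth at 0\<close>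

text \<open>On bounded intervals \<open>norm (h x)\<close> is dominated by
  \<open>1 + (norm (h x))\<^sup>2\<close>; the endpoint 0, about which \<open>L2_on {0<..}\<close>
  says nothing, is negligible.\<close>

lemma L2_on_imp_integrable_on:
  assumes "L2_on {0<..} h"
  shows "h integrable_on {0..c}" "(\<lambda>x. norm (h x)) integrable_on {0..c}"
    "(\<lambda>x. (norm (h x))\<^sup>2) integrable_on {0..c}"
proof -
  have m: "h \<in> borel_measurable (lebesgue_on {0<..c})"
    using assms unfolding L2_on_def by (auto intro: measurable_restrict_mono)
  have "(\<lambda>x. (norm (h x))\<^sup>2) absolutely_integrable_on {0<..}"
    using assms by (simp add: L2_on_def integrable_restrict_space set_integrable_def)
  then have "(\<lambda>x. (norm (h x))\<^sup>2) absolutely_integrable_on {0<..c}"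
    by (rule set_integrable_subset) auto
  then have sq: "(\<lambda>x. (norm (h x))\<^sup>2) integrable_on {0<..c}"
    by (rule set_lebesgue_integral_eq_integral)
  have one: "(\<lambda>x. 1 :: real) integrable_on {0<..c}"
    by (intro integrable_on_const bounded_set_imp_lmeasurable) auto
  have "h absolutely_integrable_on {0<..c}"
  proof (rule measurable_bounded_by_integrable_imp_absolutely_integrable[OF m])
    show "(\<lambda>x. 1 + (norm (h x))\<^sup>2) integrable_on {0<..c}"
      using one sq by (rule integrable_add)
    show "norm (h x) \<le> 1 + (norm (h x))\<^sup>2" for x
    proof -
      have "2 * norm (h x) \<le> 1 + (norm (h x))\<^sup>2"
        using zero_le_power2[of "norm (h x) - 1"] by (simp add: power2_eq_square algebra_simps)
      then show ?thesis using norm_ge_zero[of "h x"] by linarith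
    qed
  qed auto
  then have "h integrable_on {0<..c}" "(\<lambda>x. norm (h x)) integrable_on {0<..c}"
    by (simp_all add: absolutely_integrable_on_def)
  with sq show "h integrable_on {0..c}" "(\<lambda>x. norm (h x)) integrable_on {0..c}"
    "(\<lambda>x. (norm (h x))\<^sup>2) integrable_on {0..c}"
    by (auto intro: negligible_subset[of "{0::real}"] elim!: integrable_spike_set)
qed

text \<open>Integrability of \<open>h\<close> up to 0 makes \<open>g\<close> on the open half-line a
  constant plus the integral of \<open>h\<close> from 0, which is continuous at 0. The value
  \<open>g 0\<close> is unconstrained, hence the update \<open>g(0 := L)\<close>.\<close>

lemma extend_antiderivative_to_0:
  fixes g :: "real \<Rightarrow> 'b::euclidean_space"
  assumes h: "\<And>c. h integrable_on {0..c}"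
    and ftc: "\<And>a b. 0 < a \<Longrightarrow> a \<le> b \<Longrightarrow> (h has_integral g b - g a) {a..b}"
  obtains L where "(g \<longlongrightarrow> L) (at_right 0)"
    "\<And>a b. 0 \<le> a \<Longrightarrow> a \<le> b \<Longrightarrow> (h has_integral (g(0 := L)) b - (g(0 := L)) a) {a..b}"
proof
  define L where "L = g 1 - integral {0..1} h"
  have g: "g b = L + integral {0..b} h" if "b > 0" for b
  proof -
    have split: "integral {0..t} h = integral {0..s} h + (g t - g s)" if "0 < s" "s \<le> t" for s t
      unfolding integral_unique[OF ftc[OF that], symmetric]
      using that by (intro Henstock_Kurzweil_Integration.integral_combine[symmetric] h) auto
    show ?thesis
    proof (cases "b \<le> 1")
      case True
      show ?thesis unfolding L_def split[OF that True] by simp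
    next
      case False
      then show ?thesis unfolding L_def using split[of 1 b] by simp
    qed
  qed
  have "continuous_on {0..1} (\<lambda>x. integral {0..x} h)"
    by (rule indefinite_integral_continuous_1[OF h])
  then have "((\<lambda>x. integral {0..x} h) \<longlongrightarrow> integral {0..0} h) (at 0 within {0..1})"
    unfolding continuous_on_def by (rule bspec) simp
  then have "((\<lambda>x. L + integral {0..x} h) \<longlongrightarrow> L + 0) (at_right 0)"
    by (intro tendsto_intros) (simp_all add: at_within_Icc_at_right)
  moreover have "\<forall>\<^sub>F x in at_right 0. L + integral {0..x} h = g x"
    using g by (auto simp: eventually_at_filter)
  ultimately show "(g \<longlongrightarrow> L) (at_right 0)"
    by (simp add: tendsto_cong)
  show "(h has_integral (g(0 := L)) b - (g(0 := L)) a) {a..b}" if "0 \<le> a" "a \<le> b" for a b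
  proof (cases "a = 0")
    case True
    then show ?thesis
      using g[of b] that integrable_integral[OF h[of b]] by (cases "b = 0") auto
  qed (use ftc that in auto)
qed

lemma continuous_on_greaterThan_0:
  fixes F :: "real \<Rightarrow> 'b::topological_space"
  assumes "\<And>c. c > 0 \<Longrightarrow> continuous_on {0..c} F"
  shows "continuous_on {0<..} F"
proof -
  have "isCont F x" if "x > 0" for x
    using continuous_on_interior[OF assms[of "x + 1"], of x] that by simp
  then show ?thesis
    by (simp add: continuous_at_imp_continuous_on)
qed

text \<open>Integrating an asymptotic relation: if \<open>h\<close> behaves like \<open>D\<close>
  times the power \<open>k\<close>, its integral from 0 behaves like the integral of that
  power.\<close>

lemma tendsto_integral_over_power:
  fixes g :: "real \<Rightarrow> 'b::euclidean_space"
  assumes lim: "((\<lambda>x. h x /\<^sub>R x ^ k) \<longlongrightarrow> D) (at_right 0)"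
    and int: "\<And>b. b > 0 \<Longrightarrow> (h has_integral g b) {0..b}"
  shows "((\<lambda>x. g x /\<^sub>R x ^ Suc k) \<longlongrightarrow> D /\<^sub>R real (Suc k)) (at_right 0)"
proof (rule tendstoI)
  fix e :: real assume "e > 0"
  then have "e / 2 > 0" by simp
  from tendstoD[OF lim this] obtain d where "d > 0" and
    d: "\<And>x. 0 < x \<Longrightarrow> x < d \<Longrightarrow> norm (h x /\<^sub>R x ^ k - D) < e / 2"
    by (auto simp: eventually_at_right_field dist_norm)
  have "dist (g b /\<^sub>R b ^ Suc k) (D /\<^sub>R real (Suc k)) < e" if b: "0 < b" "b < d" for b
  proof -
    \<comment> \<open>The limit gives no information on \<open>h 0\<close>; this choice makes the
      error vanish at 0, so the bound \<open>close\<close> holds on the closed interval.\<close>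
    define h' where "h' x = (if x = 0 then x ^ k *\<^sub>R D else h x)" for x
    have h': "(h' has_integral g b) {0..b}"
      by (rule has_integral_spike[OF _ _ int[OF b(1)], of "{0}"]) (auto simp: h'_def)
    have pow: "((\<lambda>x. x ^ k) has_integral b ^ Suc k / real (Suc k)) {0..b}"
    proof -
      have "((\<lambda>x. x ^ k) has_integral b ^ Suc k / real (Suc k) - 0 ^ Suc k / real (Suc k)) {0..b}"
      proof (rule fundamental_theorem_of_calculus)
        show "((\<lambda>x. x ^ Suc k / real (Suc k)) has_vector_derivative x ^ k) (at x within {0..b})" for x
          using DERIV_cdivide[OF DERIV_pow[of "Suc k" x], of "real (Suc k)"]
          by (auto simp: has_real_derivative_iff_has_vector_derivative simp del: of_nat_Suc power_Suc
              intro: has_vector_derivative_at_within)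
      qed (use b in simp)
      then show ?thesis by simp
    qed
    have close: "norm (h' x - x ^ k *\<^sub>R D) \<le> (e / 2) * x ^ k" if "x \<in> {0..b}" for x
    proof (cases "x = 0")
      case False
      then have x: "x > 0" "x < d" using that b by auto
      have "h x - x ^ k *\<^sub>R D = x ^ k *\<^sub>R (h x /\<^sub>R x ^ k - D)"
        using x by (simp add: scaleR_diff_right)
      then have "norm (h x - x ^ k *\<^sub>R D) = x ^ k * norm (h x /\<^sub>R x ^ k - D)"
        using x by simp
      also have "\<dots> \<le> x ^ k * (e / 2)"
        using d[OF x] x by (intro mult_left_mono) auto
      finally show ?thesis using False by (simp add: h'_def mult.commute)
    qed (use \<open>e > 0\<close> in \<open>simp add: h'_def\<close>)
    have hd: "((\<lambda>x. h' x - x ^ k *\<^sub>R D) has_integral g b - (b ^ Suc k / real (Suc k)) *\<^sub>R D) {0..b}"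
      by (intro has_integral_diff h' has_integral_scaleR_left pow)
    have hb: "((\<lambda>x. (e / 2) * x ^ k) has_integral (e / 2) * (b ^ Suc k / real (Suc k))) {0..b}"
      by (intro has_integral_mult_right pow)
    have "norm (g b - (b ^ Suc k / real (Suc k)) *\<^sub>R D) \<le> (e / 2) * (b ^ Suc k / real (Suc k))"
      using integral_norm_bound_integral[OF has_integral_integrable[OF hd] has_integral_integrable[OF hb] close]
      by (simp only: integral_unique[OF hd] integral_unique[OF hb])
    also have "\<dots> \<le> (e / 2) * b ^ Suc k"
      using b \<open>e > 0\<close> by (intro mult_left_mono) (auto simp: field_simps)
    finally have "norm (g b - (b ^ Suc k / real (Suc k)) *\<^sub>R D) / b ^ Suc k \<le> e / 2"
      using b by (simp add: field_simps)
    moreover have "norm (g b /\<^sub>R b ^ Suc k - D /\<^sub>R real (Suc k)) =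
        norm (g b - (b ^ Suc k / real (Suc k)) *\<^sub>R D) / b ^ Suc k"
    proof -
      have "g b /\<^sub>R b ^ Suc k - D /\<^sub>R real (Suc k) =
          (1 / b ^ Suc k) *\<^sub>R (g b - (b ^ Suc k / real (Suc k)) *\<^sub>R D)"
        using b by (simp add: scaleR_diff_right divide_simps)
      then show ?thesis using b by simp
    qed
    ultimately show ?thesis using \<open>e > 0\<close> unfolding dist_norm by linarith
  qed
  then show "\<forall>\<^sub>F x in at_right 0. dist (g x /\<^sub>R x ^ Suc k) (D /\<^sub>R real (Suc k)) < e"
    using \<open>d > 0\<close> by (auto simp: eventually_at_right_field)
qed

text \<open>For \<open>D\<close> nonzero, \<open>norm (f x / of_real (x ^ n))\<close> is at least
  \<open>K / x\<close> near 0, so its square has integral at least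
  \<open>K\<^sup>2 / (4 * s)\<close> over \<open>{s..2 * s}\<close>. This is unbounded as
  \<open>s\<close> tends to 0.\<close>

lemma not_square_integrable_near_0:
  fixes f :: "real \<Rightarrow> complex"
  assumes "(\<lambda>x. (norm (f x / of_real (x ^ n)))\<^sup>2) integrable_on {0..1}"
    and lim: "((\<lambda>x. f x /\<^sub>R x ^ m) \<longlongrightarrow> D) (at_right 0)" and "m < n"
  shows "D = 0"
proof (rule ccontr)
  assume "D \<noteq> 0"
  let ?q = "\<lambda>x. (norm (f x / of_real (x ^ n)))\<^sup>2"
  define K where "K = norm D / 2"
  have "K > 0" "K < norm D" using \<open>D \<noteq> 0\<close> by (auto simp: K_def)
  have "((\<lambda>x. norm (f x /\<^sub>R x ^ m)) \<longlongrightarrow> norm D) (at_right 0)"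
    using lim by (rule tendsto_norm)
  from order_tendstoD(1)[OF this \<open>K < norm D\<close>] obtain d where "d > 0" and
    d: "\<And>x. 0 < x \<Longrightarrow> x < d \<Longrightarrow> K < norm (f x /\<^sub>R x ^ m)"
    by (auto simp: eventually_at_right_field)
  have low: "(K / x)\<^sup>2 \<le> ?q x" if x: "0 < x" "x < d" "x \<le> 1" for x
  proof (rule power_mono)
    have "x ^ n \<le> x ^ Suc m" using \<open>m < n\<close> x by (intro power_decreasing) auto
    then have "K * x ^ n \<le> K * x ^ Suc m" using \<open>K > 0\<close> by simp
    also have "\<dots> \<le> norm (f x) * x"
      using less_imp_le[OF d[OF x(1,2)]] x by (simp add: field_simps)
    finally show "K / x \<le> norm (f x / of_real (x ^ n))"
      using x by (simp add: norm_divide norm_power field_simps)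
  qed (use \<open>K > 0\<close> x in auto)
  define M where "M = integral {0..1} ?q"
  \<comment> \<open>The first two terms keep \<open>{s..2 * s}\<close> inside the region where
    \<open>low\<close> applies; the third makes \<open>K\<^sup>2 / (4 * s)\<close> at least
    \<open>\<bar>M\<bar> + 1\<close>, hence larger than \<open>M\<close>.\<close>
  define s where "s = min (min (d / 3) (1 / 2)) (K\<^sup>2 / (4 * (\<bar>M\<bar> + 1)))"
  have s: "s > 0" "2 * s < d" "2 * s \<le> 1"
  proof -
    show "s > 0" using \<open>d > 0\<close> \<open>K > 0\<close> by (auto simp: s_def intro: add_nonneg_pos)
    have "s \<le> d / 3" "s \<le> 1 / 2" unfolding s_def by linarith+
    then show "2 * s < d" "2 * s \<le> 1" using \<open>d > 0\<close> by auto
  qed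
  have int: "?q integrable_on {s..2 * s}"
    using integrable_on_subinterval[OF assms(1)] s by auto
  have "s * (K / (2 * s))\<^sup>2 = integral {s..2 * s} (\<lambda>x. (K / (2 * s))\<^sup>2)"
    using s by simp
  also have "\<dots> \<le> integral {s..2 * s} ?q"
  proof (intro integral_le int)
    fix x assume x: "x \<in> {s..2 * s}"
    have "(K / (2 * s))\<^sup>2 \<le> (K / x)\<^sup>2"
      using x s \<open>K > 0\<close> by (intro power_mono divide_left_mono) auto
    also have "\<dots> \<le> ?q x" using low x s by auto
    finally show "(K / (2 * s))\<^sup>2 \<le> ?q x" .
  qed (rule integrable_const_ivl)
  also have "\<dots> \<le> M"
    unfolding M_def using s by (intro integral_subset_le int assms(1)) auto
  finally have "s * (K / (2 * s))\<^sup>2 \<le> M" .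
  moreover have "s * (K / (2 * s))\<^sup>2 = K\<^sup>2 / (4 * s)"
    using s by (simp add: power2_eq_square)
  ultimately have "K\<^sup>2 \<le> M * (4 * s)"
    using s by (simp add: pos_divide_le_eq)
  moreover have "s * (4 * (\<bar>M\<bar> + 1)) \<le> K\<^sup>2"
  proof -
    have "s \<le> K\<^sup>2 / (4 * (\<bar>M\<bar> + 1))" by (simp add: s_def)
    then show ?thesis by (subst (asm) pos_le_divide_eq) auto
  qed
  moreover have "M * (4 * s) = s * (4 * M)" by simp
  ultimately have "s * (4 * (\<bar>M\<bar> + 1)) \<le> s * (4 * M)" by linarith
  then have "4 * (\<bar>M\<bar> + 1) \<le> 4 * M" by (rule mult_left_le_imp_le[OF _ s(1)])
  then show False using abs_ge_self[of M] by (simp add: algebra_simps)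
qed

subsection \<open>Hardy's inequality\<close>

text \<open>Cauchy--Schwarz with the weight \<open>t powr (1 / 4)\<close>, then Tonelli.\<close>

lemma hardy_nn_integral:
  fixes u :: "real \<Rightarrow> ennreal"
  assumes [measurable]: "u \<in> borel_measurable borel"
  shows "(\<integral>\<^sup>+x\<in>{0<..}. ((\<integral>\<^sup>+t\<in>{0<..x}. u t \<partial>lborel) * ennreal (1 / x))\<^sup>2 \<partial>lborel)
       \<le> 4 * (\<integral>\<^sup>+t\<in>{0<..}. (u t)\<^sup>2 \<partial>lborel)"
proof -
  \<comment> \<open>With weight exponent \<open>a\<close> between 0 and \<open>1 / 2\<close>, the
    two integrations below produce the constant \<open>1 / (2 * a * (1 - 2 * a))\<close>. It is
    smallest at \<open>a = 1 / 4\<close>, where it is 4 and the powers of \<open>t\<close>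
    cancel.\<close>
  define p where "p t = ennreal (t powr (- 1 / 4)) * indicator {0<..} t" for t :: real
  define q where "q t = ennreal (t powr (1 / 4)) * u t * indicator {0<..} t" for t
  have [measurable]: "p \<in> borel_measurable borel" "q \<in> borel_measurable borel"
    unfolding p_def[abs_def] q_def[abs_def] by measurable
  have pq: "p t * q t = u t * indicator {0<..} t" for t
  proof (cases "t > 0")
    case True
    then have "ennreal (t powr (- 1 / 4)) * ennreal (t powr (1 / 4)) = 1"
      by (simp add: ennreal_mult[symmetric] powr_add[symmetric])
    then show ?thesis
      by (simp add: p_def q_def mult.assoc[symmetric] indicator_def)
  qed (simp add: p_def q_def)
  have p2: "(\<integral>\<^sup>+t\<in>{0<..x}. (p t)\<^sup>2 \<partial>lborel) = ennreal (2 * x powr (1 / 2))" if "x > 0" for x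
  proof -
    have "((\<lambda>t. t powr (- 1 / 2)) has_integral x powr (- 1 / 2 + 1) / (- 1 / 2 + 1)) {0..x}"
      using that by (intro has_integral_powr_from_0) auto
    then have "(\<integral>\<^sup>+t. ennreal (t powr (- 1 / 2)) * indicator {0..x} t \<partial>lborel) = ennreal (2 * x powr (1 / 2))"
      by (subst nn_integral_has_integral_lebesgue') (auto simp: mult.commute)
    also have "(\<integral>\<^sup>+t. ennreal (t powr (- 1 / 2)) * indicator {0..x} t \<partial>lborel) =
        (\<integral>\<^sup>+t\<in>{0<..x}. (p t)\<^sup>2 \<partial>lborel)"
      by (intro nn_integral_cong)
        (auto simp: p_def indicator_def power2_eq_square ennreal_mult[symmetric] powr_add[symmetric])
    finally show ?thesis .
  qed
  have tail: "(\<integral>\<^sup>+x\<in>{t..}. ennreal (2 * x powr (- 3 / 2)) \<partial>lborel) = ennreal (4 * t powr (- 1 / 2))"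
    if "t > 0" for t
  proof -
    have "((\<lambda>x. 2 * x powr (- 3 / 2)) has_integral 2 * (- (t powr (- 3 / 2 + 1)) / (- 3 / 2 + 1))) {t..}"
      using that by (intro has_integral_mult_right has_integral_powr_to_inf) auto
    then show ?thesis
      by (subst nn_integral_has_integral_lebesgue') auto
  qed
  have "(\<integral>\<^sup>+x\<in>{0<..}. ((\<integral>\<^sup>+t\<in>{0<..x}. u t \<partial>lborel) * ennreal (1 / x))\<^sup>2 \<partial>lborel) \<le>
      (\<integral>\<^sup>+x. (\<integral>\<^sup>+t. (ennreal (2 * x powr (- 3 / 2)) * indicator {t..} x) * (q t)\<^sup>2 \<partial>lborel) \<partial>lborel)"
  proof (rule nn_integral_mono)
    fix x :: real
    show "((\<integral>\<^sup>+t\<in>{0<..x}. u t \<partial>lborel) * ennreal (1 / x))\<^sup>2 * indicator {0<..} x \<le>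
      (\<integral>\<^sup>+t. (ennreal (2 * x powr (- 3 / 2)) * indicator {t..} x) * (q t)\<^sup>2 \<partial>lborel)"
    proof (cases "x > 0")
      case True
      have "(\<integral>\<^sup>+t\<in>{0<..x}. u t \<partial>lborel)\<^sup>2 =
          (\<integral>\<^sup>+t. (p t * indicator {0<..x} t) * (q t * indicator {0<..x} t) \<partial>lborel)\<^sup>2"
        using pq by (intro arg_cong[of _ _ power2] nn_integral_cong) (auto simp: indicator_def)
      also have "\<dots> \<le> (\<integral>\<^sup>+t. (p t * indicator {0<..x} t)\<^sup>2 \<partial>lborel) *
          (\<integral>\<^sup>+t. (q t * indicator {0<..x} t)\<^sup>2 \<partial>lborel)"
        by (rule Cauchy_Schwarz_nn_integral) auto
      also have "(\<integral>\<^sup>+t. (p t * indicator {0<..x} t)\<^sup>2 \<partial>lborel) = (\<integral>\<^sup>+t\<in>{0<..x}. (p t)\<^sup>2 \<partial>lborel)"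
        by (intro nn_integral_cong) (auto simp: indicator_def)
      also note p2[OF True]
      finally have cs: "(\<integral>\<^sup>+t\<in>{0<..x}. u t \<partial>lborel)\<^sup>2 \<le>
          ennreal (2 * x powr (1 / 2)) * (\<integral>\<^sup>+t. (q t * indicator {0<..x} t)\<^sup>2 \<partial>lborel)" .
      have pw: "ennreal (2 * x powr (1 / 2)) * (ennreal (1 / x))\<^sup>2 = ennreal (2 * x powr (- 3 / 2))"
      proof -
        have "(1 / x)\<^sup>2 = x powr (- 2)"
          using True by (simp add: powr_minus powr_numeral divide_inverse power_inverse)
        then have "x powr (1 / 2) * (1 / x)\<^sup>2 = x powr (- 3 / 2)"
          by (simp add: powr_add[symmetric])
        then show ?thesis
          using True by (simp add: ennreal_power ennreal_mult[symmetric])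
      qed
      have "((\<integral>\<^sup>+t\<in>{0<..x}. u t \<partial>lborel) * ennreal (1 / x))\<^sup>2 =
          (\<integral>\<^sup>+t\<in>{0<..x}. u t \<partial>lborel)\<^sup>2 * (ennreal (1 / x))\<^sup>2"
        by (rule power_mult_distrib)
      also have "\<dots> \<le> (ennreal (2 * x powr (1 / 2)) * (\<integral>\<^sup>+t. (q t * indicator {0<..x} t)\<^sup>2 \<partial>lborel)) *
          (ennreal (1 / x))\<^sup>2"
        by (intro mult_right_mono cs) simp
      also have "\<dots> = ennreal (2 * x powr (- 3 / 2)) * (\<integral>\<^sup>+t. (q t * indicator {0<..x} t)\<^sup>2 \<partial>lborel)"
        by (simp only: pw[symmetric] mult_ac)
      also have "\<dots> = (\<integral>\<^sup>+t. ennreal (2 * x powr (- 3 / 2)) * (q t * indicator {0<..x} t)\<^sup>2 \<partial>lborel)"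
        by (rule nn_integral_cmult[symmetric]) measurable
      also have "\<dots> = (\<integral>\<^sup>+t. (ennreal (2 * x powr (- 3 / 2)) * indicator {t..} x) * (q t)\<^sup>2 \<partial>lborel)"
        by (intro nn_integral_cong) (auto simp: indicator_def q_def)
      finally show ?thesis using True by simp
    qed simp
  qed
  also have "\<dots> = (\<integral>\<^sup>+t. (\<integral>\<^sup>+x. (ennreal (2 * x powr (- 3 / 2)) * indicator {t..} x) * (q t)\<^sup>2 \<partial>lborel) \<partial>lborel)"
  proof (rule lborel_pair.Fubini')
    \<comment> \<open>The indicator of \<open>{t..}\<close> depends on both variables; written as
      the condition \<open>t \<le> x\<close>, it is visibly jointly measurable.\<close>
    have "(\<lambda>(t, x). (ennreal (2 * x powr (- 3 / 2)) * (if t \<le> x then 1 else 0)) * (q t)\<^sup>2)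
        \<in> borel_measurable (lborel \<Otimes>\<^sub>M lborel)"
      by measurable
    then show "(\<lambda>(t, x). (ennreal (2 * x powr (- 3 / 2)) * indicator {t..} x) * (q t)\<^sup>2)
        \<in> borel_measurable (lborel \<Otimes>\<^sub>M lborel)"
      by (simp add: indicator_def of_bool_def if_distrib cong: if_cong)
  qed
  also have "\<dots> \<le> (\<integral>\<^sup>+t. 4 * ((u t)\<^sup>2 * indicator {0<..} t) \<partial>lborel)"
  proof (rule nn_integral_mono)
    fix t :: real
    show "(\<integral>\<^sup>+x. (ennreal (2 * x powr (- 3 / 2)) * indicator {t..} x) * (q t)\<^sup>2 \<partial>lborel) \<le>
        4 * ((u t)\<^sup>2 * indicator {0<..} t)"
    proof (cases "t > 0")
      case True
      have "(ennreal (t powr (1 / 4)))\<^sup>2 = ennreal (t powr (1 / 2))"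
        by (simp add: power2_eq_square ennreal_mult[symmetric] powr_add[symmetric])
      then have q2: "(q t)\<^sup>2 = ennreal (t powr (1 / 2)) * (u t)\<^sup>2"
        using True by (simp add: q_def power_mult_distrib)
      have "(\<integral>\<^sup>+x. (ennreal (2 * x powr (- 3 / 2)) * indicator {t..} x) * (q t)\<^sup>2 \<partial>lborel) =
          (\<integral>\<^sup>+x\<in>{t..}. ennreal (2 * x powr (- 3 / 2)) \<partial>lborel) * (q t)\<^sup>2"
        by (rule nn_integral_multc) measurable
      also note tail[OF True]
      also have "ennreal (4 * t powr (- 1 / 2)) * (q t)\<^sup>2 =
          ennreal (4 * (t powr (- 1 / 2) * t powr (1 / 2))) * (u t)\<^sup>2"
        unfolding q2 by (simp add: mult.assoc[symmetric] ennreal_mult[symmetric])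
      also have "\<dots> = 4 * (u t)\<^sup>2"
        using True by (simp add: powr_add[symmetric])
      finally show ?thesis using True by simp
    qed (simp add: q_def)
  qed
  also have "\<dots> = 4 * (\<integral>\<^sup>+t\<in>{0<..}. (u t)\<^sup>2 \<partial>lborel)"
    by (rule nn_integral_cmult) measurable
  finally show ?thesis .
qed

text \<open>Transfers the Borel inequality for extended nonnegative functions to a function that is
  only Lebesgue measurable, by replacing \<open>norm (h t)\<close> on the open half-line with a
  Borel function \<open>u\<close> equal to it almost everywhere.\<close>

lemma hardy_L2_on:
  fixes h :: "real \<Rightarrow> complex"
  assumes "L2_on {0<..} h"
  shows "integrable (lebesgue_on {0<..}) (\<lambda>x. (integral {0..x} (\<lambda>t. norm (h t)) / x)\<^sup>2)"
proof -
  let ?W = "\<lambda>x. integral {0..x} (\<lambda>t. norm (h t))"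
  have int: "(\<lambda>t. norm (h t)) integrable_on {0..c}" for c
    by (rule L2_on_imp_integrable_on[OF assms])
  have "(\<lambda>t. ennreal (norm (h t)) * indicator {0<..} t) \<in> borel_measurable lebesgue"
  proof -
    have "h \<in> borel_measurable (lebesgue_on {0<..})" using assms by (simp add: L2_on_def)
    then have "(\<lambda>t. ennreal (norm (h t))) \<in> borel_measurable (lebesgue_on {0<..})"
      by measurable
    then show ?thesis by (subst (asm) borel_measurable_restrict_space_iff_ennreal) auto
  qed
  from completion_ex_borel_measurable[OF this] obtain u
    where [measurable]: "u \<in> borel_measurable borel"
      and u: "AE t in lborel. ennreal (norm (h t)) * indicator {0<..} t = u t"
    by auto
  have W: "(\<integral>\<^sup>+t\<in>{0<..x}. u t \<partial>lborel) = ennreal (?W x)" for x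
  proof -
    have "(\<integral>\<^sup>+t. ennreal (norm (h t)) * indicator {0..x} t \<partial>lborel) = ennreal (?W x)"
      by (rule nn_integral_has_integral_lebesgue') (auto intro: int)
    moreover have "AE t in lborel. ennreal (norm (h t)) * indicator {0..x} t = u t * indicator {0<..x} t"
      using u AE_lborel_singleton[of "0 :: real"]
      by eventually_elim (auto simp: indicator_def)
    ultimately show ?thesis by (simp cong: nn_integral_cong_AE)
  qed
  have fin: "(\<integral>\<^sup>+t\<in>{0<..}. (u t)\<^sup>2 \<partial>lborel) < \<infinity>"
  proof -
    have "(\<integral>\<^sup>+t\<in>{0<..}. (u t)\<^sup>2 \<partial>lborel) = (\<integral>\<^sup>+t\<in>{0<..}. ennreal ((norm (h t))\<^sup>2) \<partial>lborel)"
    proof (rule nn_integral_cong_AE)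
      show "AE t in lborel. (u t)\<^sup>2 * indicator {0<..} t = ennreal ((norm (h t))\<^sup>2) * indicator {0<..} t"
        using u
      proof eventually_elim
        case (elim t)
        show ?case unfolding elim[symmetric] by (auto simp: indicator_def ennreal_power)
      qed
    qed
    also have "\<dots> = (\<integral>\<^sup>+t. ennreal ((norm (h t))\<^sup>2) \<partial>lebesgue_on {0<..})"
      by (simp add: nn_integral_restrict_space nn_integral_completion)
    also have "\<dots> < \<infinity>"
      using assms by (simp add: L2_on_def integrable_iff_bounded)
    finally show ?thesis .
  qed
  have cont: "continuous_on {0<..} ?W"
    by (intro continuous_on_greaterThan_0 indefinite_integral_continuous_1 int)
  have meas: "(\<lambda>x. (?W x / x)\<^sup>2) \<in> borel_measurable (lebesgue_on {0<..})"
    by (intro continuous_imp_measurable_on_sets_lebesgue continuous_intros cont) auto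
  have "(\<integral>\<^sup>+x. ennreal ((?W x / x)\<^sup>2) \<partial>lebesgue_on {0<..}) =
      (\<integral>\<^sup>+x\<in>{0<..}. ((\<integral>\<^sup>+t\<in>{0<..x}. u t \<partial>lborel) * ennreal (1 / x))\<^sup>2 \<partial>lborel)"
  proof -
    have "ennreal ((?W x / x)\<^sup>2) = (ennreal (?W x) * ennreal (1 / x))\<^sup>2" if "x > 0" for x
      using that by (simp add: ennreal_mult[symmetric] ennreal_power integral_nonneg int)
    then show ?thesis
      by (auto simp: nn_integral_restrict_space nn_integral_completion W
          split: split_indicator intro!: nn_integral_cong)
  qed
  also have "\<dots> \<le> 4 * (\<integral>\<^sup>+t\<in>{0<..}. (u t)\<^sup>2 \<partial>lborel)"
    by (rule hardy_nn_integral) measurable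
  also have "\<dots> < \<infinity>"
    using fin by (simp add: ennreal_mult_less_top)
  finally show ?thesis
    using meas by (simp add: integrable_iff_bounded)
qed

subsection \<open>The two inclusions\<close>

lemma H_derivs_has_integral:
  assumes "H_derivs n f g" "j < n" "0 \<le> a" "a \<le> b"
  shows "(g (Suc j) has_integral g j b - g j a) {a..b}"
proof (rule fundamental_theorem_of_calculus_ac[OF \<open>a \<le> b\<close>])
  \<comment> \<open>\<open>b + 1\<close> rather than \<open>b\<close>: \<open>ac_loc_closed\<close>
    speaks of positive endpoints only, and \<open>b = 0\<close> is allowed here.\<close>
  have "ac_on {0..b + 1} (g j)"
    using assms by (simp add: H_derivs_def ac_loc_closed_def)
  then show "ac_on {a..b} (g j)"
    by (rule ac_on_subset) (use assms in auto)
  have "AE x in lebesgue. x > 0 \<longrightarrow> (g j has_vector_derivative g (Suc j) x) (at x)"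
    using assms by (simp add: H_derivs_def)
  then show "AE x in lebesgue. x \<in> {a<..<b} \<longrightarrow> (g j has_vector_derivative g (Suc j) x) (at x)"
    by eventually_elim (use \<open>0 \<le> a\<close> in auto)
qed

lemma Hhat_derivs_has_integral:
  assumes "Hhat_derivs n f g" "j < n" "0 < a" "a \<le> b"
  shows "(g (Suc j) has_integral g j b - g j a) {a..b}"
proof (rule fundamental_theorem_of_calculus_ac[OF \<open>a \<le> b\<close>])
  show "ac_on {a..b} (g j)"
    using assms by (simp add: Hhat_derivs_def ac_loc_open_def)
  have "AE x in lebesgue. x > 0 \<longrightarrow> (g j has_vector_derivative g (Suc j) x) (at x)"
    using assms by (simp add: Hhat_derivs_def)
  then show "AE x in lebesgue. x \<in> {a<..<b} \<longrightarrow> (g j has_vector_derivative g (Suc j) x) (at x)"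
    by eventually_elim (use \<open>0 < a\<close> in auto)
qed

section \<open>From vanishing at 0 to the weighted bound\<close>

text \<open>Induction from the top derivative downwards, each integration starting from the value 0.
  The bound at \<open>t\<close> is replaced by the larger one at \<open>x\<close>, so each step
  gains a plain factor \<open>x\<close> and the factorials of Taylor's formula are given away. The
  case \<open>i = n - 1\<close> concerns \<open>f\<close> itself.\<close>

lemma H_derivs_bound:
  assumes H: "H_derivs n f g" and "i < n" "0 \<le> x"
  shows "norm (g (n - Suc i) x) \<le> x ^ i * integral {0..x} (\<lambda>t. norm (g n t))"
  using assms(2,3)
proof (induction i arbitrary: x)
  have "L2_on {0<..} (g n)" using H by (simp add: H_derivs_def)
  note int = L2_on_imp_integrable_on[OF this]
  have g0: "g j 0 = 0" if "j < n" for j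
    using H that by (simp add: H_derivs_def)
  {
    case 0
    then have "(g n has_integral g (n - 1) x) {0..x}"
      using H_derivs_has_integral[OF H, of "n - 1" 0 x] g0[of "n - 1"] by simp
    then show ?case
      using integral_norm_bound_integral[OF int(1) int(2), of x] by (simp add: integral_unique)
  next
    case (Suc i)
    let ?W = "\<lambda>x. integral {0..x} (\<lambda>t. norm (g n t))"
    have "(g (n - Suc i) has_integral g (n - Suc (Suc i)) x) {0..x}"
      using H_derivs_has_integral[OF H, of "n - Suc (Suc i)" 0 x] g0[of "n - Suc (Suc i)"] Suc.prems
      by (simp add: Suc_diff_Suc)
    moreover have "norm (g (n - Suc i) t) \<le> x ^ i * ?W x" if "t \<in> {0..x}" for t
    proof -
      have "norm (g (n - Suc i) t) \<le> t ^ i * ?W t"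
        using Suc that by auto
      also have "\<dots> \<le> x ^ i * ?W x"
        using that by (intro mult_mono power_mono integral_subset_le int integral_nonneg) auto
      finally show ?thesis .
    qed
    moreover have "0 \<le> x ^ i * ?W x"
      using Suc.prems by (intro mult_nonneg_nonneg integral_nonneg int) auto
    ultimately have "norm (g (n - Suc (Suc i)) x) \<le> (x ^ i * ?W x) * measure lborel {0..x}"
      by (intro has_integral_bound_real[where f = "g (n - Suc i)"]) auto
    then show ?case
      using Suc.prems by (simp add: mult_ac)
  }
qed

lemma H_derivs_imp_Hhat_derivs:
  assumes H: "H_derivs n f g"
  shows "Hhat_derivs n f g"
proof -
  have eq: "g 0 x = f x" if "x > 0" for x
    using H that by (simp add: H_derivs_def)
  have L2: "L2_on {0<..} (g n)" using H by (simp add: H_derivs_def)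
  have "L2_on {0<..} (\<lambda>x. g 0 x / of_real (x ^ n))"
  \<comment> \<open>For \<open>n = 0\<close> the weight is 1 and the claim is the assumption on
    \<open>g n\<close>. Otherwise \<open>g 0\<close> is among the absolutely continuous derivatives,
    which gives measurability.\<close>
  proof (cases "n = 0")
    case False
    let ?W = "\<lambda>x. integral {0..x} (\<lambda>t. norm (g n t))"
    have "continuous_on {0<..} (g 0)"
      using H False
      by (intro continuous_on_greaterThan_0 ac_on_imp_continuous_on)
        (auto simp: H_derivs_def ac_loc_closed_def)
    then have meas: "(\<lambda>x. g 0 x / of_real (x ^ n)) \<in> borel_measurable (lebesgue_on {0<..})"
      by (intro continuous_imp_measurable_on_sets_lebesgue continuous_intros) auto
    have "integrable (lebesgue_on {0<..}) (\<lambda>x. (norm (g 0 x / of_real (x ^ n)))\<^sup>2)"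
    proof (rule Bochner_Integration.integrable_bound[OF hardy_L2_on[OF L2]])
      show "(\<lambda>x. (norm (g 0 x / of_real (x ^ n)))\<^sup>2) \<in> borel_measurable (lebesgue_on {0<..})"
        using meas by measurable
      have "norm (g 0 x / of_real (x ^ n)) \<le> ?W x / x" if "x > 0" for x
      proof -
        have "norm (g 0 x) \<le> x ^ (n - 1) * ?W x"
          using H_derivs_bound[OF H, of "n - 1" x] False that by simp
        moreover have "x ^ n = x ^ (n - 1) * x"
          using False by (cases n) auto
        ultimately show ?thesis
          using that by (simp add: norm_divide norm_mult norm_power field_simps)
      qed
      then show "AE x in lebesgue_on {0<..}.
          norm ((norm (g 0 x / of_real (x ^ n)))\<^sup>2) \<le> norm ((?W x / x)\<^sup>2)"
        by (intro AE_I2) (auto intro!: power_mono)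
    qed
    with meas show ?thesis by (simp add: L2_on_def)
  qed (use L2 in simp)
  also have "L2_on {0<..} (\<lambda>x. g 0 x / of_real (x ^ n)) \<longleftrightarrow> L2_on {0<..} (\<lambda>x. f x / of_real (x ^ n))"
    unfolding L2_on_def using eq
    by (intro conj_cong measurable_cong Bochner_Integration.integrable_cong) auto
  finally have "L2_on {0<..} (\<lambda>x. f x / of_real (x ^ n))" .
  moreover have "ac_loc_open (g j)" if "j < n" for j
    unfolding ac_loc_open_def
  proof (intro allI impI)
    fix a b :: real assume "0 < a" "a \<le> b"
    moreover from this have "ac_on {0..b} (g j)"
      using H that by (simp add: H_derivs_def ac_loc_closed_def)
    ultimately show "ac_on {a..b} (g j)"
      by (elim ac_on_subset) auto
  qed
  ultimately show ?thesis
    using H eq by (simp add: Hhat_derivs_def H_derivs_def)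
qed

section \<open>From the weighted bound to vanishing at 0\<close>

text \<open>The invariant of the downward induction. Integrability of \<open>h\<close> itself is
  listed because, for the gauge integral, it does not follow from that of the squared norm.\<close>

definition locally_square_integrable :: "(real \<Rightarrow> complex) \<Rightarrow> bool" where
  "locally_square_integrable h \<longleftrightarrow>
     (\<forall>c. h integrable_on {0..c} \<and> (\<lambda>x. (norm (h x))\<^sup>2) integrable_on {0..c})"

text \<open>One step down: the extension to 0 is absolutely continuous by square integrability of
  \<open>h\<close>, hence continuous on compact intervals. So \<open>g\<close>, which differs from
  it at most at 0, inherits the invariant.\<close>

lemma locally_square_integrable_antiderivative:
  assumes h: "locally_square_integrable h"
    and ftc: "\<And>a b. 0 < a \<Longrightarrow> a \<le> b \<Longrightarrow> (h has_integral g b - g a) {a..b}"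
  shows "locally_square_integrable g \<and> (\<exists>L. (g \<longlongrightarrow> L) (at_right 0) \<and> ac_loc_closed (g(0 := L)) \<and>
     (\<forall>b>0. (h has_integral g b - L) {0..b}))"
proof -
  obtain L where lim: "(g \<longlongrightarrow> L) (at_right 0)" and
    L: "\<And>a b. 0 \<le> a \<Longrightarrow> a \<le> b \<Longrightarrow> (h has_integral (g(0 := L)) b - (g(0 := L)) a) {a..b}"
    using extend_antiderivative_to_0[of h g, OF _ ftc] h
    unfolding locally_square_integrable_def by blast
  have ac: "ac_on {0..c} (g(0 := L))" for c
    using h L by (intro ac_onI_square_integrable[of 0 c h]) (auto simp: locally_square_integrable_def)
  have "g integrable_on {0..c} \<and> (\<lambda>x. (norm (g x))\<^sup>2) integrable_on {0..c}" for c
  proof -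
    have "continuous_on {0..c} (g(0 := L))"
      by (rule ac_on_imp_continuous_on[OF ac])
    then have "(g(0 := L)) integrable_on {0..c}" "(\<lambda>x. (norm ((g(0 := L)) x))\<^sup>2) integrable_on {0..c}"
      by (intro integrable_continuous_real continuous_intros; assumption)+
    then show ?thesis
      by (intro conjI; elim integrable_spike[where S = "{0}"]) auto
  qed
  moreover have "\<forall>b>0. (h has_integral g b - L) {0..b}"
  proof (intro allI impI)
    fix b :: real assume "b > 0"
    then show "(h has_integral g b - L) {0..b}" using L[of 0 b] by simp
  qed
  ultimately show ?thesis
    using lim ac by (auto simp: locally_square_integrable_def ac_loc_closed_def)
qed

lemma Hhat_derivs_locally_square_integrable:
  assumes H: "Hhat_derivs n f g" and "j \<le> n"
  shows "locally_square_integrable (g j)"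
  using \<open>j \<le> n\<close>
proof (induction j rule: inc_induct)
  case base
  show ?case
    using H L2_on_imp_integrable_on unfolding Hhat_derivs_def locally_square_integrable_def by blast
next
  case (step j)
  then show ?case
    using locally_square_integrable_antiderivative Hhat_derivs_has_integral[OF H] by blast
qed

lemma Hhat_derivs_limits:
  assumes H: "Hhat_derivs n f g"
  obtains L where "\<And>j. j < n \<Longrightarrow> (g j \<longlongrightarrow> L j) (at_right 0)"
    "\<And>j. j < n \<Longrightarrow> ac_loc_closed ((g j)(0 := L j))"
    "\<And>j b. j < n \<Longrightarrow> b > 0 \<Longrightarrow> (g (Suc j) has_integral g j b - L j) {0..b}"
proof -
  have "\<exists>L. (g j \<longlongrightarrow> L) (at_right 0) \<and> ac_loc_closed ((g j)(0 := L)) \<and>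
     (\<forall>b>0. (g (Suc j) has_integral g j b - L) {0..b})" if "j < n" for j
    using locally_square_integrable_antiderivative[OF
      Hhat_derivs_locally_square_integrable[OF H Suc_leI[OF that]] Hhat_derivs_has_integral[OF H that]]
    by (rule conjunct2)
  then have "\<forall>j. \<exists>L. j < n \<longrightarrow> (g j \<longlongrightarrow> L) (at_right 0) \<and> ac_loc_closed ((g j)(0 := L)) \<and>
     (\<forall>b>0. (g (Suc j) has_integral g j b - L) {0..b})"
    by blast
  from choice[OF this] obtain L where "\<forall>j. j < n \<longrightarrow> (g j \<longlongrightarrow> L j) (at_right 0) \<and>
     ac_loc_closed ((g j)(0 := L j)) \<and> (\<forall>b>0. (g (Suc j) has_integral g j b - L j) {0..b})"
    by (rule exE)
  then show thesis
    by (intro that[of L]) simp_all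
qed

text \<open>If \<open>m\<close> is the least index with a nonzero limit \<open>L m\<close>, then repeated integration shows that
  \<open>f x / x ^ m\<close> tends to a nonzero multiple of \<open>L m\<close>, so \<open>f / x ^ n\<close> is not square integrable.\<close>

lemma Hhat_derivs_limits_eq_0:
  assumes H: "Hhat_derivs n f g" and "m < n"
    and lim: "\<And>j. j < n \<Longrightarrow> (g j \<longlongrightarrow> L j) (at_right 0)"
    and int: "\<And>j b. j < n \<Longrightarrow> b > 0 \<Longrightarrow> (g (Suc j) has_integral g j b - L j) {0..b}"
  shows "L m = 0"
  using \<open>m < n\<close>
proof (induction m rule: less_induct)
  case (less m)
  \<comment> \<open>After \<open>i\<close> integrations the factor is the reciprocal of
    \<open>i\<close> factorial; only its positivity matters.\<close>
  have "\<exists>r>0. ((\<lambda>x. g (m - i) x /\<^sub>R x ^ i) \<longlongrightarrow> r *\<^sub>R L m) (at_right 0)" if "i \<le> m" for i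
    using that
  proof (induction i)
    case 0
    then show ?case using lim[OF less.prems] by (intro exI[of _ 1]) simp
  next
    case (Suc i)
    then obtain r where "r > 0" and
      r: "((\<lambda>x. g (m - i) x /\<^sub>R x ^ i) \<longlongrightarrow> r *\<^sub>R L m) (at_right 0)"
      by auto
    \<comment> \<open>Indices below \<open>m\<close> are covered by the outer induction, so this
      integration adds no constant that would dominate the power.\<close>
    have "L (m - Suc i) = 0" using less Suc.prems by auto
    then have "(g (m - i) has_integral g (m - Suc i) b) {0..b}" if "b > 0" for b
      using int[of "m - Suc i" b] that Suc.prems less.prems by (simp add: Suc_diff_Suc)
    from tendsto_integral_over_power[OF r this] \<open>r > 0\<close> show ?case
      by (intro exI[of _ "r / real (Suc i)"]) (simp add: divide_inverse mult.commute del: of_nat_Suc power_Suc)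
  qed
  from this[of m] obtain r where "r > 0" and
    r: "((\<lambda>x. g 0 x /\<^sub>R x ^ m) \<longlongrightarrow> r *\<^sub>R L m) (at_right 0)"
    by auto
  have "\<forall>\<^sub>F x in at_right 0. g 0 x /\<^sub>R x ^ m = f x /\<^sub>R x ^ m"
    using H by (auto simp: Hhat_derivs_def eventually_at_filter)
  with r have "((\<lambda>x. f x /\<^sub>R x ^ m) \<longlongrightarrow> r *\<^sub>R L m) (at_right 0)"
    by (simp add: tendsto_cong)
  moreover have "(\<lambda>x. (norm (f x / of_real (x ^ n)))\<^sup>2) integrable_on {0..1}"
    using H by (intro L2_on_imp_integrable_on) (simp add: Hhat_derivs_def)
  ultimately have "r *\<^sub>R L m = 0"
    using not_square_integrable_near_0 less.prems by blast
  with \<open>r > 0\<close> show ?case by simp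
qed

theorem theorem3p4:
  fixes n :: nat
  shows "(\<forall>f. f \<in> H_space n \<longrightarrow> f \<in> Hhat_space n) \<and>
         (\<forall>f g. Hhat_derivs n f g \<longrightarrow>
             (\<forall>j<n. \<exists>L. (g j \<longlongrightarrow> L) (at_right 0)) \<and>
             f(0 := Lim (at_right 0) f) \<in> H_space n)"
proof (intro conjI allI impI)
  show "f \<in> Hhat_space n" if "f \<in> H_space n" for f
    using that H_derivs_imp_Hhat_derivs by (auto simp: H_space_def Hhat_space_def)
next
  fix f g assume H: "Hhat_derivs n f g"
  obtain L where L: "\<And>j. j < n \<Longrightarrow> (g j \<longlongrightarrow> L j) (at_right 0)"
    "\<And>j. j < n \<Longrightarrow> ac_loc_closed ((g j)(0 := L j))"
    "\<And>j b. j < n \<Longrightarrow> b > 0 \<Longrightarrow> (g (Suc j) has_integral g j b - L j) {0..b}"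
    using Hhat_derivs_limits[OF H] by blast
  show "\<exists>L. (g j \<longlongrightarrow> L) (at_right 0)" if "j < n" for j
    using L(1) that by blast
  have L0: "L j = 0" if "j < n" for j
    using Hhat_derivs_limits_eq_0[OF H that L(1,3)] .
  \<comment> \<open>For \<open>n = 0\<close> the limit need not exist and \<open>l\<close> is then
    an unspecified value, which is harmless since no condition is imposed at 0. For
    \<open>n > 0\<close> it is the genuine limit 0.\<close>
  define l where "l = Lim (at_right 0) f"
  have l: "l = 0" if "n > 0"
  proof -
    have "\<forall>\<^sub>F x in at_right 0. g 0 x = f x"
      using H by (auto simp: Hhat_derivs_def eventually_at_filter)
    then have "(f \<longlongrightarrow> 0) (at_right 0)"
      using L(1)[OF that] L0[OF that] by (simp add: tendsto_cong)
    then show ?thesis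
      unfolding l_def by (intro tendsto_Lim) simp_all
  qed
  \<comment> \<open>One formula serves both cases: \<open>G 0\<close> must take the value
    \<open>l\<close> at 0 even when \<open>n = 0\<close>, and for \<open>n > 0\<close> every
    derivative receives the required value 0.\<close>
  define G where "G j = (g j)(0 := l)" for j
  have G: "G j = (g j)(0 := 0)" if "j < n" for j
    using l that by (simp add: G_def)
  have "H_derivs n (f(0 := l)) G"
    unfolding H_derivs_def
  proof (intro conjI allI impI)
    show "G 0 x = (f(0 := l)) x" if "x \<ge> 0" for x
      using H that by (simp add: G_def Hhat_derivs_def)
    show "ac_loc_closed (G j)" "G j 0 = 0" if "j < n" for j
      using L(2) L0 G that by auto
    show "AE x in lebesgue. x > 0 \<longrightarrow> (G j has_vector_derivative G (Suc j) x) (at x)" if "j < n" for j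
    proof -
      have "AE x in lebesgue. x > 0 \<longrightarrow> (g j has_vector_derivative g (Suc j) x) (at x)"
        using H that by (simp add: Hhat_derivs_def)
      then show ?thesis
      proof eventually_elim
        case (elim x)
        show ?case
        proof
          assume "x > 0"
          then have "(g j has_vector_derivative G (Suc j) x) (at x)"
            using elim by (simp add: G_def)
          then show "(G j has_vector_derivative G (Suc j) x) (at x)"
            \<comment> \<open>The change at the single point 0 is invisible on the open half-line,
              so it does not affect derivatives at \<open>x > 0\<close>.\<close>
            by (rule has_vector_derivative_transform_within_open[of _ _ _ "{0<..}"])
              (use \<open>x > 0\<close> in \<open>auto simp: G_def\<close>)
        qed
      qed
    qed
    have "L2_on {0<..} (g n)" using H by (simp add: Hhat_derivs_def)
    then show "L2_on {0<..} (G n)"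
      unfolding L2_on_def
      by (elim conj_forward iffD1[OF measurable_cong, rotated]
            iffD1[OF Bochner_Integration.integrable_cong[OF refl], rotated])
        (auto simp: G_def)
  qed
  then show "f(0 := Lim (at_right 0) f) \<in> H_space n"
    unfolding H_space_def l_def by blast
qed

end
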